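(* Let $f\in\Gamma_0(\mathbb{R}^{M_V})$, $\mathbf{C}$, $\mathbf{d}$, $\mathbf{P}$ and $\rho>0$ be as in the context, assume $\mathbf{T}_1$ is maximal monotone and $\mathrm{fix}(\mathbf{T}_{P,\rho})\neq\emptyset$, and let $\mathbf{z}^*\in\mathrm{fix}(\mathbf{T}_{P,\rho})$ with corresponding primal and dual vectors $\mathbf{x}^*,\boldsymbol{\lambda}^*$. Let $(\mathbf{x}^{(k)})_{k\ge1}$, $(\boldsymbol{\lambda}^{(k)})_{k\ge1}$ be primal and dual sequences generated by PDMM from an arbitrary $\mathbf{z}^{(0)}\in\mathbb{R}^{M_E}$. Then: (i) if $f$ is strictly convex, then $\lim_{k\to\infty}\mathbf{x}^{(k)}=\mathbf{x}^*$; (ii) if $f$ is differentiable, i.e. $\partial f=\nabla f$ on $\mathbb{R}^{M_V}$, then $\lim_{k\to\infty}\Pi_{\mathrm{ran}(\mathbf{C})}(\boldsymbol{\lambda}^{(k)})=\Pi_{\mathrm{ran}(\mathbf{C})}(\boldsymbol{\lambda}^* )$.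
   Context: $\Gamma_0(\mathbb{R}^n)$ is the set of closed, convex, proper functions $\mathbb{R}^n\to\mathbb{R}\cup\{+\infty\}$; $f^*$ is the Fenchel conjugate; $\Pi_S$ is orthogonal projection onto the subspace $S$. Network setting: $\mathbf{G}(V,E)$ is an undirected graph with nodes $V=\{1,\dots,N\}$ and neighbour sets $\mathcal{N}(i)=\{j:(i,j)\in E\}$. Node $i$ has $f_i\in\Gamma_0(\mathbb{R}^{M_i})$. For each edge $(i,j)\in E$ there are matrices $\mathbf{A}_{i|j}\in\mathbb{R}^{M_{ij}\times M_i}$, $\mathbf{A}_{j|i}\in\mathbb{R}^{M_{ij}\times M_j}$ and a vector $\mathbf{b}_{ij}=\mathbf{b}_{ji}\in\mathbb{R}^{M_{ij}}$ (with $M_{ij}=M_{ji}$). The problem is $\min\sum_{i}f_i(\mathbf{x}_i)$ subject to $\mathbf{A}_{i|j}\mathbf{x}_i+\mathbf{A}_{j|i}\mathbf{x}_j=\mathbf{b}_{ij}$ for all $(i,j)\in E$. Set $M_V=\sum_iM_i$ and $f(\mathbf{x})=\sum_if_i(\mathbf{x}_i)$. Let $M_E=\sum_{i\in V}\sum_{j\in\mathcal{N}(i)}M_{ij}$ (sum over directed edges $i|j$), and index vectors in $\mathbb{R}^{M_E}$ by blocks $\boldsymbol{\lambda}_{i|j}\in\mathbb{R}^{M_{ij}}$, ordered first by $i$, then by $j$. $\mathbf{C}\in\mathbb{R}^{M_E\times M_V}$ is block diagonal with blocks $\mathbf{C}_i$, where $\mathbf{C}_i$ stacks vertically $\mathbf{A}_{i|j}$,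 $j\in\mathcal{N}(i)$; so $(\mathbf{C}\mathbf{x})_{i|j}=\mathbf{A}_{i|j}\mathbf{x}_i$. $\mathbf{d}\in\mathbb{R}^{M_E}$ has blocks $\mathbf{d}_{i|j}=\tfrac12\mathbf{b}_{ij}$. $\mathbf{P}$ is the symmetric permutation matrix with $(\mathbf{P}\boldsymbol{\lambda})_{i|j}=\boldsymbol{\lambda}_{j|i}$ (so $\mathbf{P}^2=\mathbf{I}$, $\mathbf{P}\mathbf{d}=\mathbf{d}$). PDMM: $\mathbf{T}_1=\mathbf{C}\,\partial f^*(\mathbf{C}^T\,\cdot)-\mathbf{d}$. When $\mathbf{T}_1$ is maximal monotone, the PDMM operator $\mathbf{T}_{P,\rho}=\mathbf{P}\circ(2(\mathbf{I}+\rho\mathbf{T}_1)^{-1}-\mathbf{I})$ is single valued and defined on all of $\mathbb{R}^{M_E}$. PDMM generates, for $k\ge0$, $\mathbf{x}^{(k+1)}\in\arg\min_{\mathbf{x}}\big(f(\mathbf{x})-\langle\mathbf{C}^T\mathbf{z}^{(k)},\mathbf{x}\rangle+\frac{\rho}{2}\|\mathbf{C}\mathbf{x}-\mathbf{d}\|^2\big)$, $\ \boldsymbol{\lambda}^{(k+1)}=\mathbf{z}^{(k)}-\rho(\mathbf{C}\mathbf{x}^{(k+1)}-\mathbf{d})$, $\ \mathbf{z}^{(k+1)}=\mathbf{P}(2\boldsymbol{\lambda}^{(k+1)}-\mathbf{z}^{(k)})$, which is the iteration $\mathbf{z}^{(k+1)}=\mathbf{T}_{P,\rho}(\mathbf{z}^{(k)})$.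 For a fixed point $\mathbf{z}^*$, the corresponding $\mathbf{x}^*,\boldsymbol{\lambda}^*$ are the primal and dual vectors produced by these formulas when $\mathbf{z}^{(k)}=\mathbf{z}^*$. *)

theory Defs
  imports "HOL-Analysis.Analysis"
begin

text \<open>
  The dimensions of the node and edge spaces vary with the node and the edge, so a Euclidean
  space is given by a finite set \<open>I\<close> of coordinate labels: \<open>\<real>\<^sup>I\<close> is the set of functions
  vanishing outside \<open>I\<close> (compare \<open>Euclidean_space\<close> in the library). Its norm is \<open>L2_set _ I\<close>;
  the product topology of the function type restricts to the usual topology on it, so that
  \<open>closed\<close> and limits of sequences have their usual meaning.
\<close>

definition Rsp :: "'a set \<Rightarrow> ('a \<Rightarrow> real) set" where
  "Rsp I = {x. \<forall>a. a \<notin> I \<longrightarrow> x a = 0}"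

definition ip :: "'a set \<Rightarrow> ('a \<Rightarrow> real) \<Rightarrow> ('a \<Rightarrow> real) \<Rightarrow> real" where
  "ip I x y = (\<Sum>a\<in>I. x a * y a)"

definition mat_vec :: "'b set \<Rightarrow> 'a set \<Rightarrow> ('b \<Rightarrow> 'a \<Rightarrow> real) \<Rightarrow> ('a \<Rightarrow> real) \<Rightarrow> 'b \<Rightarrow> real" where
  "mat_vec J I Q x = (\<lambda>e. if e \<in> J then (\<Sum>a\<in>I. Q e a * x a) else 0)"

definition orth_proj :: "'a set \<Rightarrow> ('a \<Rightarrow> real) set \<Rightarrow> ('a \<Rightarrow> real) \<Rightarrow> 'a \<Rightarrow> real" where
  "orth_proj I S x = (THE p. p \<in> S \<and> (\<forall>s\<in>S. ip I (\<lambda>a. x a - p a) s = 0))"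


section \<open>Convex functions\<close>

definition convex_fn :: "'a set \<Rightarrow> (('a \<Rightarrow> real) \<Rightarrow> ereal) \<Rightarrow> bool" where
  "convex_fn I f \<longleftrightarrow>
     (\<forall>x\<in>Rsp I. \<forall>y\<in>Rsp I. \<forall>t::real. 0 < t \<and> t < 1 \<longrightarrow>
        f (\<lambda>a. t * x a + (1 - t) * y a) \<le> ereal t * f x + ereal (1 - t) * f y)"

definition strictly_convex_fn :: "'a set \<Rightarrow> (('a \<Rightarrow> real) \<Rightarrow> ereal) \<Rightarrow> bool" where
  "strictly_convex_fn I f \<longleftrightarrow>
     (\<forall>x\<in>Rsp I. \<forall>y\<in>Rsp I. \<forall>t::real. f x < \<infinity> \<and> f y < \<infinity> \<and> x \<noteq> y \<and> 0 < t \<and> t < 1 \<longrightarrow>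
        f (\<lambda>a. t * x a + (1 - t) * y a) < ereal t * f x + ereal (1 - t) * f y)"

definition epigraph :: "'a set \<Rightarrow> (('a \<Rightarrow> real) \<Rightarrow> ereal) \<Rightarrow> (('a \<Rightarrow> real) \<times> real) set" where
  "epigraph I f = {(x, r). x \<in> Rsp I \<and> f x \<le> ereal r}"

definition Gamma0 :: "'a set \<Rightarrow> (('a \<Rightarrow> real) \<Rightarrow> ereal) set" where
  "Gamma0 I = {f. (\<forall>x\<in>Rsp I. f x \<noteq> -\<infinity>) \<and> (\<exists>x\<in>Rsp I. f x \<noteq> \<infinity>) \<and>
                  convex_fn I f \<and> closed (epigraph I f)}"

definition conjugate :: "'a set \<Rightarrow> (('a \<Rightarrow> real) \<Rightarrow> ereal) \<Rightarrow> ('a \<Rightarrow> real) \<Rightarrow> ereal" where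
  "conjugate I f u = (SUP x\<in>Rsp I. ereal (ip I u x) - f x)"

definition subdiff :: "'a set \<Rightarrow> (('a \<Rightarrow> real) \<Rightarrow> ereal) \<Rightarrow> ('a \<Rightarrow> real) \<Rightarrow> ('a \<Rightarrow> real) set" where
  "subdiff I f x =
     {u \<in> Rsp I. \<forall>y\<in>Rsp I. f x + ereal (ip I u (\<lambda>a. y a - x a)) \<le> f y}"

definition has_gradient ::
  "'a set \<Rightarrow> (('a \<Rightarrow> real) \<Rightarrow> ereal) \<Rightarrow> ('a \<Rightarrow> real) \<Rightarrow> ('a \<Rightarrow> real) \<Rightarrow> bool" where
  "has_gradient I f x g \<longleftrightarrow> g \<in> Rsp I \<and>
     (\<forall>\<epsilon>>0. \<exists>\<delta>>0. \<forall>h\<in>Rsp I. L2_set h I < \<delta> \<longrightarrow>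
        \<bar>real_of_ereal (f (\<lambda>a. x a + h a)) - real_of_ereal (f x) - ip I g h\<bar> \<le> \<epsilon> * L2_set h I)"

definition differentiable_fn :: "'a set \<Rightarrow> (('a \<Rightarrow> real) \<Rightarrow> ereal) \<Rightarrow> bool" where
  "differentiable_fn I f \<longleftrightarrow> (\<forall>x\<in>Rsp I. \<bar>f x\<bar> \<noteq> \<infinity>) \<and> (\<forall>x\<in>Rsp I. \<exists>g. has_gradient I f x g)"


section \<open>Set-valued operators\<close>

definition monotone_op :: "'a set \<Rightarrow> (('a \<Rightarrow> real) \<Rightarrow> ('a \<Rightarrow> real) set) \<Rightarrow> bool" where
  "monotone_op I T \<longleftrightarrow> (\<forall>x\<in>Rsp I. T x \<subseteq> Rsp I) \<and>
     (\<forall>x\<in>Rsp I. \<forall>y\<in>Rsp I. \<forall>u\<in>T x. \<forall>v\<in>T y. 0 \<le> ip I (\<lambda>a. u a - v a) (\<lambda>a. x a - y a))"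

definition maximal_monotone :: "'a set \<Rightarrow> (('a \<Rightarrow> real) \<Rightarrow> ('a \<Rightarrow> real) set) \<Rightarrow> bool" where
  "maximal_monotone I T \<longleftrightarrow> monotone_op I T \<and>
     (\<forall>S. monotone_op I S \<and> (\<forall>x\<in>Rsp I. T x \<subseteq> S x) \<longrightarrow> (\<forall>x\<in>Rsp I. S x = T x))"

text \<open>The set-valued inverse of the identity plus \<open>\<rho> T\<close>.\<close>

definition resolvent ::
  "'a set \<Rightarrow> real \<Rightarrow> (('a \<Rightarrow> real) \<Rightarrow> ('a \<Rightarrow> real) set) \<Rightarrow> ('a \<Rightarrow> real) \<Rightarrow> ('a \<Rightarrow> real) set" where
  "resolvent I \<rho> T z = {y \<in> Rsp I. \<exists>u\<in>T y. z = (\<lambda>a. y a + \<rho> * u a)}"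

definition fix_pts :: "'a set \<Rightarrow> (('a \<Rightarrow> real) \<Rightarrow> ('a \<Rightarrow> real) set) \<Rightarrow> ('a \<Rightarrow> real) set" where
  "fix_pts I T = {z \<in> Rsp I. z \<in> T z}"


section \<open>The network problem\<close>

text \<open>
  An undirected edge is stored in both directions, so \<open>(i, j) \<in> edges G\<close> ranges over the directed
  edges \<open>i|j\<close>. The \<open>(r, c)\<close> entry of the matrix of \<open>i|j\<close> is \<open>edge_mat G i j r c\<close>, and the
  \<open>r\<close>-th entry of the right-hand side of the constraint on this edge is \<open>edge_rhs G i j r\<close>.
\<close>

record network =
  num_nodes :: nat
  edges :: "(nat \<times> nat) set"
  node_dim :: "nat \<Rightarrow> nat"
  edge_dim :: "nat \<Rightarrow> nat \<Rightarrow> nat"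
  node_fun :: "nat \<Rightarrow> (nat \<Rightarrow> real) \<Rightarrow> ereal"
  edge_mat :: "nat \<Rightarrow> nat \<Rightarrow> nat \<Rightarrow> nat \<Rightarrow> real"
  edge_rhs :: "nat \<Rightarrow> nat \<Rightarrow> nat \<Rightarrow> real"

definition nodes :: "network \<Rightarrow> nat set" where
  "nodes G = {1..num_nodes G}"

definition valid_network :: "network \<Rightarrow> bool" where
  "valid_network G \<longleftrightarrow>
     edges G \<subseteq> nodes G \<times> nodes G \<and> sym (edges G) \<and>
     (\<forall>i\<in>nodes G. node_fun G i \<in> Gamma0 {1..node_dim G i}) \<and>
     (\<forall>(i, j)\<in>edges G. edge_dim G i j = edge_dim G j i \<and>
        (\<forall>r\<in>{1..edge_dim G i j}. edge_rhs G i j r = edge_rhs G j i r))"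

text \<open>
  Coordinate labels of the primal space of dimension \<open>M\<^sub>V\<close> and of the dual space of dimension
  \<open>M\<^sub>E\<close>: \<open>(i, c)\<close> is entry \<open>c\<close> of block \<open>i\<close>, and \<open>(i, j, r)\<close> is entry \<open>r\<close> of block \<open>i|j\<close>.
\<close>

definition primal_ix :: "network \<Rightarrow> (nat \<times> nat) set" where
  "primal_ix G = {(i, c). i \<in> nodes G \<and> c \<in> {1..node_dim G i}}"

definition dual_ix :: "network \<Rightarrow> (nat \<times> nat \<times> nat) set" where
  "dual_ix G = {(i, j, r). (i, j) \<in> edges G \<and> r \<in> {1..edge_dim G i j}}"

definition net_fun :: "network \<Rightarrow> (nat \<times> nat \<Rightarrow> real) \<Rightarrow> ereal" where
  "net_fun G x = (\<Sum>i\<in>nodes G. node_fun G i (\<lambda>c. x (i, c)))"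

definition net_mat :: "network \<Rightarrow> nat \<times> nat \<times> nat \<Rightarrow> nat \<times> nat \<Rightarrow> real" where
  "net_mat G = (\<lambda>(i, j, r) (k, c). if i = k then edge_mat G i j r c else 0)"

definition opC :: "network \<Rightarrow> (nat \<times> nat \<Rightarrow> real) \<Rightarrow> nat \<times> nat \<times> nat \<Rightarrow> real" where
  "opC G = mat_vec (dual_ix G) (primal_ix G) (net_mat G)"

definition opCt :: "network \<Rightarrow> (nat \<times> nat \<times> nat \<Rightarrow> real) \<Rightarrow> nat \<times> nat \<Rightarrow> real" where
  "opCt G = mat_vec (primal_ix G) (dual_ix G) (\<lambda>a e. net_mat G e a)"

definition vecd :: "network \<Rightarrow> nat \<times> nat \<times> nat \<Rightarrow> real" where
  "vecd G = (\<lambda>(i, j, r). if (i, j, r) \<in> dual_ix G then edge_rhs G i j r / 2 else 0)"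

definition opP :: "(nat \<times> nat \<times> nat \<Rightarrow> real) \<Rightarrow> nat \<times> nat \<times> nat \<Rightarrow> real" where
  "opP l = (\<lambda>(i, j, r). l (j, i, r))"

definition ranC :: "network \<Rightarrow> (nat \<times> nat \<times> nat \<Rightarrow> real) set" where
  "ranC G = opC G ` Rsp (primal_ix G)"


section \<open>PDMM\<close>

definition T1 :: "network \<Rightarrow> (nat \<times> nat \<times> nat \<Rightarrow> real) \<Rightarrow> (nat \<times> nat \<times> nat \<Rightarrow> real) set" where
  "T1 G l = (\<lambda>x e. opC G x e - vecd G e) `
     subdiff (primal_ix G) (conjugate (primal_ix G) (net_fun G)) (opCt G l)"

definition TP ::
  "network \<Rightarrow> real \<Rightarrow> (nat \<times> nat \<times> nat \<Rightarrow> real) \<Rightarrow> (nat \<times> nat \<times> nat \<Rightarrow> real) set" where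
  "TP G \<rho> z = (\<lambda>l. opP (\<lambda>e. 2 * l e - z e)) ` resolvent (dual_ix G) \<rho> (T1 G) z"

definition pdmm_objective ::
  "network \<Rightarrow> real \<Rightarrow> (nat \<times> nat \<times> nat \<Rightarrow> real) \<Rightarrow> (nat \<times> nat \<Rightarrow> real) \<Rightarrow> ereal" where
  "pdmm_objective G \<rho> z x =
     net_fun G x - ereal (ip (primal_ix G) (opCt G z) x)
       + ereal (\<rho> / 2 * (L2_set (\<lambda>e. opC G x e - vecd G e) (dual_ix G))\<^sup>2)"

text \<open>\<open>x\<close> and \<open>l\<close> are primal and dual vectors produced by one pass of the formulas from \<open>z\<close>.\<close>

definition pdmm_pair ::
  "network \<Rightarrow> real \<Rightarrow> (nat \<times> nat \<times> nat \<Rightarrow> real) \<Rightarrow> (nat \<times> nat \<Rightarrow> real)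
     \<Rightarrow> (nat \<times> nat \<times> nat \<Rightarrow> real) \<Rightarrow> bool" where
  "pdmm_pair G \<rho> z x l \<longleftrightarrow>
     is_arg_min (pdmm_objective G \<rho> z) (\<lambda>y. y \<in> Rsp (primal_ix G)) x \<and>
     l = (\<lambda>e. z e - \<rho> * (opC G x e - vecd G e))"

text \<open>Only the terms with positive index of the primal and dual sequences are constrained.\<close>

definition pdmm_sequences ::
  "network \<Rightarrow> real \<Rightarrow> (nat \<Rightarrow> nat \<times> nat \<times> nat \<Rightarrow> real) \<Rightarrow> (nat \<Rightarrow> nat \<times> nat \<Rightarrow> real)
     \<Rightarrow> (nat \<Rightarrow> nat \<times> nat \<times> nat \<Rightarrow> real) \<Rightarrow> bool" where
  "pdmm_sequences G \<rho> z x l \<longleftrightarrow>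
     z 0 \<in> Rsp (dual_ix G) \<and>
     (\<forall>k. pdmm_pair G \<rho> (z k) (x (Suc k)) (l (Suc k)) \<and>
          z (Suc k) = opP (\<lambda>e. 2 * l (Suc k) e - z k e))"

end

theory Submission imports Defs begin

text \<open>
  Optimality of the primal update gives \<open>C\<^sup>T \<lambda>\<^sup>k \<in> \<partial>f(x\<^sup>k)\<close>, and the squared distance of \<open>z\<^sup>k\<close> to
  a fixed point drops in each step by \<open>4 \<rho> \<langle>C\<^sup>T(\<lambda>\<^sup>k - \<lambda>\<^sup>*), x\<^sup>k - x\<^sup>*\<rangle>\<close>. Hence these inner products tend
  to 0. Each of them is the sum of the two nonnegative Bregman gaps
  \<open>f(x\<^sup>k) - f(x\<^sup>*) - \<langle>C\<^sup>T \<lambda>\<^sup>*, x\<^sup>k - x\<^sup>*\<rangle>\<close> and \<open>f(x\<^sup>*) - f(x\<^sup>k) - \<langle>C\<^sup>T \<lambda>\<^sup>k, x\<^sup>* - x\<^sup>k\<rangle>\<close>. If \<open>f\<close> is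
  strictly convex, a vanishing first gap forces \<open>x\<^sup>k \<rightarrow> x\<^sup>*\<close>. The second gap makes \<open>C\<^sup>T \<lambda>\<^sup>k\<close> an
  approximate subgradient at \<open>x\<^sup>*\<close>, so it converges to the gradient there if \<open>f\<close> is differentiable,
  and the projection of \<open>\<lambda>\<^sup>k\<close> onto the range of \<open>C\<close> is a linear function of \<open>C\<^sup>T \<lambda>\<^sup>k\<close>.
\<close>

section \<open>Coordinate spaces\<close>

lemma ip_commute: "ip I x y = ip I y x"
  by (simp add: ip_def mult.commute)

lemma ip_add_left: "ip I (\<lambda>a. x a + y a) w = ip I x w + ip I y w"
  and ip_diff_left: "ip I (\<lambda>a. x a - y a) w = ip I x w - ip I y w"
  and ip_scale_left: "ip I (\<lambda>a. t * x a) w = t * ip I x w"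
  by (simp_all add: ip_def algebra_simps sum.distrib sum_subtractf sum_distrib_left)

lemma ip_add_right: "ip I w (\<lambda>a. x a + y a) = ip I w x + ip I w y"
  and ip_diff_right: "ip I w (\<lambda>a. x a - y a) = ip I w x - ip I w y"
  and ip_scale_right: "ip I w (\<lambda>a. t * x a) = t * ip I w x"
  by (simp_all add: ip_def algebra_simps sum.distrib sum_subtractf sum_distrib_left)

lemmas ip_linear = ip_add_left ip_diff_left ip_scale_left ip_add_right ip_diff_right ip_scale_right

lemma ip_sum_left: "ip I (\<lambda>a. \<Sum>w\<in>W. g w * h w a) y = (\<Sum>w\<in>W. g w * ip I (h w) y)"
  unfolding ip_def sum_distrib_right sum_distrib_left
  by (subst sum.swap) (simp add: mult.assoc)

lemma ip_self_nonneg: "0 \<le> ip I x x"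
  by (simp add: ip_def sum_nonneg)

lemma ip_self_eq_0_iff: "finite I \<Longrightarrow> ip I x x = 0 \<longleftrightarrow> (\<forall>a\<in>I. x a = 0)"
  by (simp add: ip_def sum_nonneg_eq_0_iff)

lemma ip_unit: "finite I \<Longrightarrow> a \<in> I \<Longrightarrow> ip I u (\<lambda>b. if b = a then t else 0) = u a * t"
  by (simp add: ip_def if_distrib cong: if_cong)

lemma square_coordinate_le_ip: "finite I \<Longrightarrow> a \<in> I \<Longrightarrow> (x a)\<^sup>2 \<le> ip I x x"
  unfolding ip_def power2_eq_square
  by (rule member_le_sum) auto

lemma L2_set_square: "(L2_set x I)\<^sup>2 = ip I x x"
  by (simp add: L2_set_def ip_def sum_nonneg power2_eq_square)

lemma Rsp_combination:
  "x \<in> Rsp I \<Longrightarrow> y \<in> Rsp I \<Longrightarrow> (\<lambda>a. s * x a + t * y a) \<in> Rsp I"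
  by (simp add: Rsp_def)

lemma Rsp_diff: "x \<in> Rsp I \<Longrightarrow> y \<in> Rsp I \<Longrightarrow> (\<lambda>a. x a - y a) \<in> Rsp I"
  by (simp add: Rsp_def)

lemma mat_vec_in_Rsp: "mat_vec J I Q x \<in> Rsp J"
  by (simp add: mat_vec_def Rsp_def)

lemma mat_vec_adjoint: "ip J (mat_vec J I Q x) y = ip I x (mat_vec I J (\<lambda>a e. Q e a) y)"
  unfolding ip_def mat_vec_def
  by (simp add: sum_distrib_left sum_distrib_right cong: sum.cong)
     (subst sum.swap, simp add: mult_ac)

lemma mat_vec_combination:
  "mat_vec J I Q (\<lambda>a. s * x a + t * y a) e = s * mat_vec J I Q x e + t * mat_vec J I Q y e"
  by (simp add: mat_vec_def algebra_simps sum.distrib sum_distrib_left)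

lemma mat_vec_diff:
  "mat_vec J I Q (\<lambda>a. x a - y a) e = mat_vec J I Q x e - mat_vec J I Q y e"
  by (simp add: mat_vec_def algebra_simps sum_subtractf)

section \<open>Topology of the coordinate spaces\<close>

lemma tendsto_coordinatewise_iff:
  fixes f :: "'c \<Rightarrow> 'a \<Rightarrow> 'b::topological_space"
  shows "(f \<longlongrightarrow> g) F \<longleftrightarrow> (\<forall>a. ((\<lambda>k. f k a) \<longlongrightarrow> g a) F)"
  using limitin_componentwise[of "\<lambda>_. euclidean" UNIV f g F]
  by (simp add: euclidean_product_topology)

text \<open>Tychonoff's theorem for a product of compact intervals, one for every label of the
  type.\<close>

lemma compact_coordinate_box:
  fixes lo hi :: "'a \<Rightarrow> real"
  shows "compact {x. \<forall>a. lo a \<le> x a \<and> x a \<le> hi a}"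
proof -
  have "compactin (product_topology (\<lambda>_. euclidean) UNIV) (PiE UNIV (\<lambda>a. {lo a..hi a}))"
    by (subst compactin_PiE) auto
  moreover have "PiE UNIV (\<lambda>a. {lo a..hi a}) = {x. \<forall>a. lo a \<le> x a \<and> x a \<le> hi a}"
    by auto
  ultimately show ?thesis
    by (simp add: euclidean_product_topology)
qed

lemma continuous_on_ip_affine:
  "continuous_on UNIV (\<lambda>y :: 'a \<Rightarrow> real. ip I u (\<lambda>a. y a - x a))"
  unfolding ip_def
  by (intro continuous_intros continuous_on_product_coordinates)

text \<open>Heine-Borel for the sphere of squared radius \<open>\<epsilon>\<close>: it is cut out by
  closed conditions and fits into a coordinate box of half-width \<open>sqrt \<epsilon>\<close>. On
  labels outside \<open>I\<close> both \<open>y\<close> and the centre vanish.\<close>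

lemma compact_sphere:
  assumes I: "finite I" and x: "x \<in> Rsp I"
  shows "compact {y \<in> Rsp I. ip I (\<lambda>a. y a - x a) (\<lambda>a. y a - x a) = \<epsilon>}" (is "compact ?K")
proof -
  let ?hi = "\<lambda>a. x a + sqrt \<epsilon>" and ?lo = "\<lambda>a. x a - sqrt \<epsilon>"
  let ?B = "{y. \<forall>a. ?lo a \<le> y a \<and> y a \<le> ?hi a}"
  have cont: "continuous_on UNIV (\<lambda>y :: 'a \<Rightarrow> real. ip I (\<lambda>a. y a - x a) (\<lambda>a. y a - x a))"
    unfolding ip_def by (intro continuous_intros continuous_on_product_coordinates)
  have "closed (\<Inter>a\<in>-I. {y :: 'a \<Rightarrow> real. y a = 0})"
    by (intro closed_INT ballI closed_Collect_eq continuous_intros continuous_on_product_coordinates)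
  moreover have "closed {y. ip I (\<lambda>a. y a - x a) (\<lambda>a. y a - x a) = \<epsilon>}"
    by (intro closed_Collect_eq continuous_intros cont)
  moreover have "?K = (\<Inter>a\<in>-I. {y. y a = 0}) \<inter> {y. ip I (\<lambda>a. y a - x a) (\<lambda>a. y a - x a) = \<epsilon>}"
    by (auto simp: Rsp_def)
  ultimately have "closed ?K"
    by (simp add: closed_Int)
  moreover have "?K \<subseteq> ?B"
  proof clarify
    fix y a assume y: "y \<in> Rsp I" and e: "\<epsilon> = ip I (\<lambda>a. y a - x a) (\<lambda>a. y a - x a)"
    have "(y a - x a)\<^sup>2 \<le> ip I (\<lambda>a. y a - x a) (\<lambda>a. y a - x a)"
    proof (cases "a \<in> I")
      case True
      then show ?thesis using square_coordinate_le_ip[OF I True, of "\<lambda>a. y a - x a"] by simp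
    next
      case False
      then show ?thesis using x y ip_self_nonneg by (auto simp: Rsp_def)
    qed
    then have "\<bar>y a - x a\<bar> \<le> sqrt (ip I (\<lambda>a. y a - x a) (\<lambda>a. y a - x a))"
      by (metis real_sqrt_abs real_sqrt_le_iff)
    then show "x a - sqrt (ip I (\<lambda>a. y a - x a) (\<lambda>a. y a - x a)) \<le> y a
        \<and> y a \<le> x a + sqrt (ip I (\<lambda>a. y a - x a) (\<lambda>a. y a - x a))"
      by linarith
  qed
  ultimately show ?thesis
    using compact_Int_closed[OF compact_coordinate_box[of ?lo ?hi], of ?K]
    by (simp add: inf.absorb2)
qed


section \<open>Orthogonal projection onto the range of a matrix\<close>

text \<open>
  Gram--Schmidt on the columns. The vectors of \<open>W\<close> lie in the range, so the coefficients
  \<open>\<langle>w, v\<rangle>\<close> of the projection of \<open>v\<close> only depend on the image of \<open>v\<close> under the transpose.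
\<close>

lemma range_projection_frame:
  assumes J: "finite J" and I: "finite I"
  shows "\<exists>W. finite W \<and> W \<subseteq> mat_vec J I Q ` Rsp I \<and>
    (\<forall>v. \<forall>x\<in>Rsp I. ip J (\<lambda>e. v e - (\<Sum>w\<in>W. ip J w v * w e)) (mat_vec J I Q x) = 0)"
  using I
proof (induction I rule: finite_induct)
  case empty
  show ?case
    by (rule exI[of _ "{}"]) (simp add: mat_vec_def ip_def)
next
  case (insert b I)
  let ?C = "mat_vec J I Q" and ?C' = "mat_vec J (insert b I) Q"
  obtain W where W: "finite W" "W \<subseteq> ?C ` Rsp I"
    and orth: "\<And>v x. x \<in> Rsp I \<Longrightarrow> ip J (\<lambda>e. v e - (\<Sum>w\<in>W. ip J w v * w e)) (?C x) = 0"
    using insert.IH by blast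
  \<comment> \<open>\<open>c\<close> is the new column, and \<open>r\<close> is what remains of it
    after subtracting its expansion over the old frame.\<close>
  define c where "c = (\<lambda>e. if e \<in> J then Q e b else 0)"
  define r where "r = (\<lambda>e. c e - (\<Sum>w\<in>W. ip J w c * w e))"
  have sub: "?C' x = ?C x" if "x \<in> Rsp I" for x
    using that insert.hyps by (auto simp: mat_vec_def Rsp_def fun_eq_iff)
  have split: "?C' x = (\<lambda>e. ?C (x(b := 0)) e + x b * c e)" for x
    using insert.hyps
    by (auto simp: mat_vec_def c_def fun_eq_iff mult.commute intro!: sum.cong)
  have mem: "x(b := 0) \<in> Rsp I" if "x \<in> Rsp (insert b I)" for x
    using that by (auto simp: Rsp_def)
  have inc: "Rsp I \<subseteq> Rsp (insert b I)"
    by (auto simp: Rsp_def)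
  have r_orth: "ip J r (?C x) = 0" if "x \<in> Rsp I" for x
    unfolding r_def using orth[OF that] .
  have r_W: "ip J r w = 0" "ip J w r = 0" if "w \<in> W" for w
    using that W(2) r_orth by (auto simp: ip_commute)
  \<comment> \<open>Chosen preimages of the frame vectors; they serve to write \<open>r\<close>
    itself as an image.\<close>
  define g where "g = inv_into (Rsp I) ?C"
  have g: "g w \<in> Rsp I" "?C (g w) = w" if "w \<in> W" for w
    using subsetD[OF W(2) that] unfolding g_def by (simp_all add: inv_into_into f_inv_into_f)
  have "?C ` Rsp I \<subseteq> ?C' ` Rsp (insert b I)"
    using sub inc by (metis image_cong image_mono)
  with W(2) have WC': "W \<subseteq> ?C' ` Rsp (insert b I)"
    by blast
  \<comment> \<open>The unit vector at \<open>b\<close> maps to \<open>c\<close>, and the subtracted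
    preimages map to the expansion of \<open>c\<close> over \<open>W\<close>, so \<open>v\<close>
    maps to \<open>r\<close>.\<close>
  define v where "v = (\<lambda>a. (if a = b then 1 else 0) - (\<Sum>w\<in>W. ip J w c * g w a))"
  have v: "v \<in> Rsp (insert b I)"
    using g by (auto simp: v_def Rsp_def intro!: sum.neutral)
  have vC: "?C' v = r"
  proof
    fix e
    have b0: "g w b = 0" if "w \<in> W" for w
      using g[OF that] insert.hyps by (simp add: Rsp_def)
    show "?C' v e = r e"
    proof (cases "e \<in> J")
      case True
      have "(\<Sum>a\<in>I. Q e a * v a) = (\<Sum>a\<in>I. - (\<Sum>w\<in>W. ip J w c * (Q e a * g w a)))"
        using insert.hyps by (auto simp: v_def sum_distrib_left mult_ac intro!: sum.cong)
      also have "\<dots> = - (\<Sum>w\<in>W. ip J w c * (\<Sum>a\<in>I. Q e a * g w a))"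
        by (simp add: sum_negf sum_distrib_left) (rule sum.swap)
      also have "\<dots> = - (\<Sum>w\<in>W. ip J w c * w e)"
      proof -
        have "(\<Sum>a\<in>I. Q e a * g w a) = w e" if "w \<in> W" for w
          using fun_cong[OF g(2)[OF that], of e] True by (simp add: mat_vec_def)
        then show ?thesis by simp
      qed
      moreover have "v b = 1"
        using b0 by (simp add: v_def)
      ultimately show ?thesis
        using True insert.hyps by (simp add: mat_vec_def r_def c_def)
    next
      case False
      have "w e = 0" if "w \<in> W" for w
        using W(2) that False by (auto simp: mat_vec_def)
      then have "(\<Sum>w\<in>W. ip J w c * w e) = 0"
        by (intro sum.neutral) simp
      then show ?thesis
        using False by (simp add: mat_vec_def r_def) (simp add: c_def)
    qed
  qed
  have c_eq: "c = (\<lambda>e. r e + (\<Sum>w\<in>W. ip J w c * w e))"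
    by (simp add: r_def)
  \<comment> \<open>Since \<open>c\<close> is \<open>r\<close> plus a combination of
    \<open>W\<close>, orthogonality to the old range and to \<open>r\<close> already gives
    orthogonality to the new range.\<close>
  have reduce: "ip J u (?C' x) = 0"
    if u: "\<And>x. x \<in> Rsp I \<Longrightarrow> ip J u (?C x) = 0" and ur: "ip J u r = 0"
      and x: "x \<in> Rsp (insert b I)" for u x
  proof -
    have "ip J u w = 0" if "w \<in> W" for w
      using that W(2) u by auto
    then have "ip J (\<lambda>e. \<Sum>w\<in>W. ip J w c * w e) u = 0"
      unfolding ip_sum_left by (simp add: ip_commute)
    then have "ip J u c = 0"
      using ur by (subst c_eq) (simp add: ip_linear ip_commute)
    then show ?thesis
      using u[OF mem[OF x]] by (simp add: split ip_linear)
  qed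
  show ?case
  proof (cases "ip J r r = 0")
    case True
    \<comment> \<open>Here the new column depends on the old ones, so the frame stays as it
      is.\<close>
    have "ip J u r = 0" for u
      using True ip_self_eq_0_iff[OF J] by (simp add: ip_def)
    then show ?thesis
      using W(1) WC' reduce orth by (intro exI[of _ W]) blast
  next
    case False
    define q where "q = (\<lambda>e. (1 / sqrt (ip J r r)) * r e)"
    have pos: "ip J r r > 0"
      using False ip_self_nonneg[of J r] by linarith
    have qr: "ip J q r = sqrt (ip J r r)"
      using pos unfolding q_def ip_scale_left by (simp add: real_div_sqrt)
    \<comment> \<open>\<open>q\<close> has positive inner product with \<open>r\<close>, whereas all
      of \<open>W\<close> is orthogonal to \<open>r\<close>; hence the sum over
      \<open>insert q W\<close> splits.\<close>
    have qW: "q \<notin> W"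
      using r_W(2)[of q] qr pos by auto
    have "q = ?C' (\<lambda>a. (1 / sqrt (ip J r r)) * v a)"
      using mat_vec_combination[of J "insert b I" Q "1 / sqrt (ip J r r)" v 0 v]
      by (simp add: q_def vC fun_eq_iff)
    moreover have "(\<lambda>a. (1 / sqrt (ip J r r)) * v a) \<in> Rsp (insert b I)"
      using v by (simp add: Rsp_def)
    ultimately have "insert q W \<subseteq> ?C' ` Rsp (insert b I)"
      using WC' by blast
    moreover have "ip J (\<lambda>e. u e - (\<Sum>w\<in>insert q W. ip J w u * w e)) (?C' x) = 0"
      if x: "x \<in> Rsp (insert b I)" for u x
    proof (rule reduce[OF _ _ x])
      have eq: "(\<lambda>e. u e - (\<Sum>w\<in>insert q W. ip J w u * w e)) =
          (\<lambda>e. (u e - (\<Sum>w\<in>W. ip J w u * w e)) - ip J q u * q e)"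
        using qW W(1) by (simp add: fun_eq_iff)
      have q0: "ip J q (?C y) = 0" if "y \<in> Rsp I" for y
        using r_orth[OF that] unfolding q_def ip_scale_left by simp
      show "ip J (\<lambda>e. u e - (\<Sum>w\<in>insert q W. ip J w u * w e)) (?C y) = 0" if "y \<in> Rsp I" for y
        unfolding eq ip_diff_left[of J "\<lambda>e. u e - (\<Sum>w\<in>W. ip J w u * w e)"] ip_scale_left
        using orth[OF that] q0[OF that] by simp
      have "ip J (\<lambda>e. \<Sum>w\<in>W. ip J w u * w e) r = 0"
        unfolding ip_sum_left using r_W(2) by simp
      \<comment> \<open>As \<open>q\<close> is \<open>r\<close> normalised, subtracting the
        \<open>q\<close>-component of \<open>u\<close> removes exactly the inner product of
        \<open>u\<close> with \<open>r\<close>.\<close>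
      moreover have "ip J q u * ip J q r = ip J u r"
        using pos unfolding qr unfolding q_def ip_scale_left by (simp add: ip_commute)
      ultimately show "ip J (\<lambda>e. u e - (\<Sum>w\<in>insert q W. ip J w u * w e)) r = 0"
        unfolding eq by (simp add: ip_linear)
    qed
    ultimately show ?thesis
      using W(1) by (intro exI[of _ "insert q W"]) blast
  qed
qed

text \<open>The frame expansion satisfies the defining property of the projection. Two candidates
  coincide because their difference lies in the range and is orthogonal to it, hence to itself. The
  projection thereby becomes a finite sum through which limits can be taken.\<close>

lemma orth_proj_range_expansion:
  assumes J: "finite J" and I: "finite I"
  obtains W where "finite W" "W \<subseteq> mat_vec J I Q ` Rsp I"
    "\<And>v. orth_proj J (mat_vec J I Q ` Rsp I) v = (\<lambda>e. \<Sum>w\<in>W. ip J w v * w e)"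
proof -
  let ?C = "mat_vec J I Q"
  obtain W where W: "finite W" "W \<subseteq> ?C ` Rsp I"
    and orth: "\<And>v x. x \<in> Rsp I \<Longrightarrow> ip J (\<lambda>e. v e - (\<Sum>w\<in>W. ip J w v * w e)) (?C x) = 0"
    using range_projection_frame[OF J I, of Q] by blast
  have span: "(\<lambda>e. \<Sum>w\<in>U. t w * w e) \<in> ?C ` Rsp I" if "U \<subseteq> ?C ` Rsp I" "finite U" for t U
    using that(2,1)
  proof (induction U rule: finite_induct)
    case empty
    have "(\<lambda>e. 0) = ?C (\<lambda>a. 0)" "(\<lambda>a. 0) \<in> Rsp I"
      by (simp_all add: mat_vec_def Rsp_def fun_eq_iff)
    then show ?case by auto
  next
    case (insert w U)
    then obtain x y where "x \<in> Rsp I" "w = ?C x" "y \<in> Rsp I" "(\<lambda>e. \<Sum>w\<in>U. t w * w e) = ?C y"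
      by blast
    then have "(\<lambda>e. \<Sum>w\<in>insert w U. t w * w e) = ?C (\<lambda>a. t w * x a + 1 * y a)"
      unfolding fun_eq_iff mat_vec_combination using insert.hyps by (simp add: fun_eq_iff)
    moreover have "(\<lambda>a. t w * x a + 1 * y a) \<in> Rsp I"
      using \<open>x \<in> Rsp I\<close> \<open>y \<in> Rsp I\<close> by (rule Rsp_combination)
    ultimately show ?case by blast
  qed
  have "orth_proj J (?C ` Rsp I) v = (\<lambda>e. \<Sum>w\<in>W. ip J w v * w e)" (is "_ = ?p") for v
    unfolding orth_proj_def
  proof (rule the_equality)
    show "?p \<in> ?C ` Rsp I \<and> (\<forall>s\<in>?C ` Rsp I. ip J (\<lambda>a. v a - ?p a) s = 0)"
      using span[OF W(2,1)] orth by auto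
  next
    fix q assume q: "q \<in> ?C ` Rsp I \<and> (\<forall>s\<in>?C ` Rsp I. ip J (\<lambda>a. v a - q a) s = 0)"
    obtain x y where xy: "x \<in> Rsp I" "q = ?C x" "y \<in> Rsp I" "?p = ?C y"
      using q span[OF W(2,1), of "\<lambda>w. ip J w v"] by blast
    have d: "(\<lambda>e. q e - ?p e) = ?C (\<lambda>a. x a - y a)"
      using xy by (simp add: fun_eq_iff mat_vec_diff)
    have dm: "(\<lambda>a. x a - y a) \<in> Rsp I"
      using xy Rsp_diff by blast
    have "ip J (\<lambda>e. v e - q e) (\<lambda>e. q e - ?p e) = 0" "ip J (\<lambda>e. v e - ?p e) (\<lambda>e. q e - ?p e) = 0"
      using q orth dm unfolding d by auto
    then have "ip J (\<lambda>e. q e - ?p e) (\<lambda>e. q e - ?p e) = 0"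
      by (simp add: ip_linear)
    then have "\<forall>e\<in>J. q e = ?p e"
      unfolding ip_self_eq_0_iff[OF J] by simp
    moreover have "q e = ?p e" if "e \<notin> J" for e
      unfolding xy(2) fun_cong[OF xy(4)] using that by (simp add: mat_vec_def)
    ultimately show "q = ?p" by blast
  qed
  then show thesis using that W by blast
qed


section \<open>Convex functions and subgradients\<close>

lemma Gamma0_finite_value:
  assumes "f \<in> Gamma0 I" "x \<in> Rsp I" "f x \<noteq> \<infinity>"
  obtains r where "f x = ereal r"
  using assms by (cases "f x") (auto simp: Gamma0_def)

lemma Gamma0_convex_value:
  assumes f: "f \<in> Gamma0 I" and xy: "x \<in> Rsp I" "y \<in> Rsp I" "f x = ereal r" "f y = ereal s"
    and t: "0 < t" "t < 1"
  obtains p where "f (\<lambda>a. t * x a + (1 - t) * y a) = ereal p" "p \<le> t * r + (1 - t) * s"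
proof -
  let ?w = "\<lambda>a. t * x a + (1 - t) * y a"
  have "f ?w \<le> ereal t * f x + ereal (1 - t) * f y"
    using f xy(1,2) t by (auto simp: Gamma0_def convex_fn_def)
  then have le: "f ?w \<le> ereal (t * r + (1 - t) * s)"
    by (simp add: xy)
  have w: "?w \<in> Rsp I"
    using xy by (intro Rsp_combination)
  have "f ?w \<noteq> - \<infinity>"
    using f w unfolding Gamma0_def by blast
  then show thesis
  proof (cases "f ?w")
    case (real p)
    then show thesis
      using le by (intro that[of p]) simp_all
  qed (use le in simp_all)
qed

lemma subdiff_le:
  "u \<in> subdiff I f x \<Longrightarrow> y \<in> Rsp I \<Longrightarrow> f x + ereal (ip I u (\<lambda>a. y a - x a)) \<le> f y"
  by (simp add: subdiff_def)

lemma subdiffD: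
  assumes "u \<in> subdiff I f x" "y \<in> Rsp I" "f x = ereal r" "f y = ereal s"
  shows "r + ip I u (\<lambda>a. y a - x a) \<le> s"
proof -
  have "f x + ereal (ip I u (\<lambda>a. y a - x a)) \<le> f y"
    using assms(1,2) by (simp add: subdiff_def)
  then show ?thesis by (simp add: assms)
qed

text \<open>A subgradient \<open>u\<close> at \<open>x\<close> makes the supremum defining the
  conjugate at \<open>u\<close> attained at \<open>x\<close>. The same \<open>x\<close> yields an
  affine minorant of the conjugate, which is therefore tight at \<open>u\<close> and has slope
  \<open>x\<close>.\<close>

lemma subdiff_conjugate:
  assumes x: "x \<in> Rsp I" "f x = ereal r" and u: "u \<in> subdiff I f x"
  shows "x \<in> subdiff I (conjugate I f) u"
proof -
  have "conjugate I f u \<le> ereal (ip I u x - r)"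
    unfolding conjugate_def
  proof (rule SUP_least)
    fix y assume "y \<in> Rsp I"
    then have "f x + ereal (ip I u (\<lambda>a. y a - x a)) \<le> f y"
      using u by (simp add: subdiff_def)
    then show "ereal (ip I u y) - f y \<le> ereal (ip I u x - r)"
      using x by (cases "f y") (auto simp: ip_linear)
  qed
  moreover have "ereal (ip I v x - r) \<le> conjugate I f v" for v
    unfolding conjugate_def using SUP_upper[OF x(1), of "\<lambda>y. ereal (ip I v y) - f y"] x by simp
  ultimately have "conjugate I f u + ereal (ip I x (\<lambda>a. v a - u a)) \<le> conjugate I f v" for v
  proof -
    have "conjugate I f u + ereal (ip I x (\<lambda>a. v a - u a))
        \<le> ereal (ip I u x - r) + ereal (ip I x (\<lambda>a. v a - u a))"
      by (rule add_right_mono) fact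
    also have "\<dots> = ereal (ip I v x - r)"
      by (simp add: ip_linear ip_commute)
    finally show ?thesis
      using \<open>\<And>v. ereal (ip I v x - r) \<le> conjugate I f v\<close> order_trans by blast
  qed
  then show ?thesis using x by (simp add: subdiff_def)
qed

text \<open>First-order optimality: compare \<open>x\<close> with points on the segment towards
  \<open>y\<close>, bound \<open>f\<close> there by convexity, divide by the step length and let it
  tend to 0. Only the linear part of the quadratic penalty survives, and it merges with
  \<open>z\<close> into the dual update.\<close>

lemma argmin_penalized_subgradient:
  fixes \<rho> :: real and z d :: "'b \<Rightarrow> real"
  defines "\<Phi> \<equiv> \<lambda>f I J Q y. f y - ereal (ip I (mat_vec I J (\<lambda>a e. Q e a) z) y)
       + ereal (\<rho> / 2 * (L2_set (\<lambda>e. mat_vec J I Q y e - d e) J)\<^sup>2)"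
  assumes f: "f \<in> Gamma0 I" and x: "x \<in> Rsp I"
    and min: "\<And>y. y \<in> Rsp I \<Longrightarrow> \<Phi> f I J Q x \<le> \<Phi> f I J Q y"
  obtains r where "f x = ereal r"
    "mat_vec I J (\<lambda>a e. Q e a) (\<lambda>e. z e - \<rho> * (mat_vec J I Q x e - d e)) \<in> subdiff I f x"
proof -
  let ?C = "mat_vec J I Q" and ?Ct = "mat_vec I J (\<lambda>a e. Q e a)"
  let ?l = "\<lambda>e. z e - \<rho> * (?C x e - d e)"
  obtain x0 where x0: "x0 \<in> Rsp I" "f x0 \<noteq> \<infinity>"
    using f by (auto simp: Gamma0_def)
  then obtain r0 where "f x0 = ereal r0"
    using Gamma0_finite_value[OF f] by blast
  then have "f x \<noteq> \<infinity>"
    using min[OF x0(1)] unfolding \<Phi>_def by auto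
  then obtain r where r: "f x = ereal r"
    using Gamma0_finite_value[OF f x] by blast
  have "f x + ereal (ip I (?Ct ?l) (\<lambda>a. y a - x a)) \<le> f y" if y: "y \<in> Rsp I" for y
  proof (cases "f y = \<infinity>")
    case True
    then show ?thesis by simp
  next
    case False
    then obtain s where s: "f y = ereal s"
      using Gamma0_finite_value[OF f y] by blast
    \<comment> \<open>Along the segment the objective increases by at most
      \<open>t * A + t * t * B\<close>, where \<open>b\<close> is the image of the direction
      \<open>y - x\<close>. The bound \<open>0 \<le> A\<close> is the desired subgradient
      inequality.\<close>
    define b where "b = (\<lambda>e. ?C y e - ?C x e)"
    define A where "A = s - r - ip J z b + \<rho> * ip J (\<lambda>e. ?C x e - d e) b"
    define B where "B = \<rho> / 2 * ip J b b"
    have key: "0 \<le> A + t * B" if t: "0 < t" "t < 1" for t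
    proof -
      let ?w = "\<lambda>a. t * y a + (1 - t) * x a"
      obtain p where p: "f ?w = ereal p" "p \<le> t * s + (1 - t) * r"
        by (rule Gamma0_convex_value[of f I y x s r t, OF f y x s r t])
      have w: "?w \<in> Rsp I"
        using x y by (intro Rsp_combination)
      have Cw: "(\<lambda>e. ?C ?w e - d e) = (\<lambda>e. (?C x e - d e) + t * b e)"
        unfolding mat_vec_combination by (simp add: b_def fun_eq_iff algebra_simps)
      have q: "(L2_set (\<lambda>e. ?C ?w e - d e) J)\<^sup>2 = (L2_set (\<lambda>e. ?C x e - d e) J)\<^sup>2
          + 2 * t * ip J (\<lambda>e. ?C x e - d e) b + t\<^sup>2 * ip J b b"
        unfolding L2_set_square Cw ip_add_left ip_add_right ip_scale_left ip_scale_right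
        by (simp add: ip_commute power2_eq_square algebra_simps)
      have zb: "ip J z b = ip I (?Ct z) y - ip I (?Ct z) x"
        unfolding b_def ip_diff_right
        by (simp add: ip_commute[of J z] ip_commute[of I "?Ct z"] mat_vec_adjoint)
      have "r - ip I (?Ct z) x + \<rho> / 2 * (L2_set (\<lambda>e. ?C x e - d e) J)\<^sup>2
          \<le> p - ip I (?Ct z) ?w + \<rho> / 2 * (L2_set (\<lambda>e. ?C ?w e - d e) J)\<^sup>2"
        using min[OF w] by (simp add: \<Phi>_def r p)
      then have "0 \<le> t * A + t * t * B"
        unfolding q ip_add_right ip_scale_right A_def B_def zb using p(2)
        by (simp add: algebra_simps power2_eq_square)
      then have "0 \<le> t * (A + t * B)"
        by (simp add: algebra_simps)
      then show ?thesis using t by (simp add: zero_le_mult_iff)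
    qed
    have "((\<lambda>t. A + t * B) \<longlongrightarrow> A + 0 * B) (at_right 0)"
      by (intro tendsto_intros)
    moreover have "eventually (\<lambda>t. 0 \<le> A + t * B) (at_right 0)"
      using eventually_at_right_less[of "0::real"] eventually_at_right_field[of _ "0::real"] key
      by (auto intro!: exI[of _ 1])
    ultimately have "0 \<le> A + 0 * B"
      using tendsto_lowerbound trivial_limit_at_right_real by blast
    moreover have "ip I (?Ct ?l) (\<lambda>a. y a - x a) = ip J ?l b"
    proof -
      have "ip I (?Ct ?l) (\<lambda>a. y a - x a) = ip J (?C (\<lambda>a. y a - x a)) ?l"
        by (simp add: mat_vec_adjoint ip_commute)
      also have "?C (\<lambda>a. y a - x a) = b"
        by (simp add: b_def fun_eq_iff mat_vec_diff)
      finally show ?thesis by (simp add: ip_commute)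
    qed
    moreover have "ip J ?l b = ip J z b - \<rho> * ip J (\<lambda>e. ?C x e - d e) b"
      unfolding ip_diff_left[of J z] ip_scale_left ..
    ultimately show ?thesis
      by (simp add: r s A_def)
  qed
  then have "?Ct ?l \<in> subdiff I f x"
    by (simp add: subdiff_def mat_vec_in_Rsp)
  then show thesis using that r by blast
qed

text \<open>If \<open>f\<close> met its supporting affine function at a second point, strict
  convexity would put the value at the midpoint strictly below that function.\<close>

lemma strictly_convex_touching_point_unique:
  assumes f: "strictly_convex_fn I f" and x: "x \<in> Rsp I" "f x = ereal r" and u: "u \<in> subdiff I f x"
    and y: "y \<in> Rsp I" "f y \<le> ereal (r + ip I u (\<lambda>a. y a - x a))"
  shows "y = x"
proof (rule ccontr)
  assume "y \<noteq> x"
  let ?w = "\<lambda>a. (1/2) * y a + (1 - 1/2) * x a"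
  have w: "?w \<in> Rsp I"
    using x y by (intro Rsp_combination)
  have "f x + ereal (ip I u (\<lambda>a. y a - x a)) \<le> f y"
    using u y(1) by (simp add: subdiff_def)
  then have fy: "f y = ereal (r + ip I u (\<lambda>a. y a - x a))"
    using y(2) x(2) by simp
  have "f ?w < ereal (1/2) * f y + ereal (1 - 1/2) * f x"
    using f[unfolded strictly_convex_fn_def, rule_format, OF y(1) x(1), of "1/2"] fy x(2) \<open>y \<noteq> x\<close>
    by simp
  then have "f ?w < ereal (r + ip I u (\<lambda>a. y a - x a) / 2)"
    unfolding fy x(2) by (simp add: field_simps)
  moreover have "f x + ereal (ip I u (\<lambda>a. ?w a - x a)) \<le> f ?w"
    using u w by (rule subdiff_le)
  moreover have "ip I u (\<lambda>a. ?w a - x a) = ip I u (\<lambda>a. y a - x a) / 2"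
    unfolding ip_diff_right ip_add_right ip_scale_right by (simp add: field_simps)
  ultimately show False
    using x(2) by (metis leD plus_ereal.simps(1))
qed

text \<open>
  Closedness and compactness bound the gap from below on a sphere around \<open>x\<close>, and convexity
  propagates this bound to everything outside the sphere.
\<close>

lemma strictly_convex_small_gap_imp_close:
  assumes I: "finite I" and f: "f \<in> Gamma0 I" and sc: "strictly_convex_fn I f"
    and x: "x \<in> Rsp I" "f x = ereal r" and u: "u \<in> subdiff I f x" and \<epsilon>: "\<epsilon> > 0"
  shows "\<exists>\<delta>>0. \<forall>y\<in>Rsp I. f y \<le> ereal (r + ip I u (\<lambda>a. y a - x a) + \<delta>) \<longrightarrow>
    ip I (\<lambda>a. y a - x a) (\<lambda>a. y a - x a) < \<epsilon>"
proof -
  let ?q = "\<lambda>y. ip I (\<lambda>a. y a - x a) (\<lambda>a. y a - x a)"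
  let ?K = "{y \<in> Rsp I. ?q y = \<epsilon>}"
  \<comment> \<open>Nested sublevel sets of the Bregman gap, with tolerances tending to 0; each is
    closed as a preimage of the epigraph under a continuous map.\<close>
  define F where "F = (\<lambda>n::nat. {y \<in> Rsp I. f y \<le> ereal (r + ip I u (\<lambda>a. y a - x a) + 1 / Suc n)})"
  have closed: "closed (F n)" for n
  proof -
    have "continuous_on UNIV (\<lambda>y. (y, r + ip I u (\<lambda>a. y a - x a) + 1 / Suc n))"
      by (intro continuous_intros continuous_on_ip_affine)
    moreover have "closed (epigraph I f)"
      using f by (simp add: Gamma0_def)
    ultimately have "closed ((\<lambda>y. (y, r + ip I u (\<lambda>a. y a - x a) + 1 / Suc n)) -` epigraph I f)"
      by (rule closed_vimage[rotated])
    moreover have "(\<lambda>y. (y, r + ip I u (\<lambda>a. y a - x a) + 1 / Suc n)) -` epigraph I f = F n"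
      by (auto simp: F_def epigraph_def)
    ultimately show ?thesis by simp
  qed
  have mono: "F n \<subseteq> F m" if "m \<le> n" for m n
  proof -
    have "1 / real (Suc n) \<le> 1 / real (Suc m)"
      using that by (simp add: field_simps)
    then show ?thesis
      unfolding F_def by (auto elim!: order_trans)
  qed
  \<comment> \<open>Otherwise compactness of the sphere yields a point on it lying in every
    \<open>F n\<close>, so with zero gap, and by uniqueness that point is \<open>x\<close>.\<close>
  have "\<exists>n. ?K \<inter> F n = {}"
  proof (rule ccontr)
    assume ne: "\<nexists>n. ?K \<inter> F n = {}"
    have "?K \<inter> (\<Inter>n\<in>UNIV. F n) \<noteq> {}"
    proof (rule compact_imp_fip_image[OF compact_sphere[OF I x(1)] closed])
      fix N :: "nat set" assume N: "finite N"
      \<comment> \<open>Inserting 0 gives \<open>Max\<close> a nonempty argument also when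
        \<open>N\<close> is empty.\<close>
      have "F (Max (insert 0 N)) \<subseteq> (\<Inter>n\<in>N. F n)"
        using N by (intro INT_greatest mono) simp
      then show "?K \<inter> (\<Inter>n\<in>N. F n) \<noteq> {}"
        using ne by blast
    qed
    then obtain y where y: "y \<in> Rsp I" "?q y = \<epsilon>" "\<And>n. y \<in> F n"
      by blast
    have "f y \<noteq> \<infinity>"
      using y(3)[of 0] by (auto simp: F_def)
    then obtain s where s: "f y = ereal s"
      using Gamma0_finite_value[OF f y(1)] by blast
    have "s \<le> r + ip I u (\<lambda>a. y a - x a) + inverse (real (Suc n))" for n
      using y(3)[of n] by (simp add: F_def s inverse_eq_divide)
    moreover have "(\<lambda>n. r + ip I u (\<lambda>a. y a - x a) + inverse (real (Suc n)))
        \<longlonglongrightarrow> r + ip I u (\<lambda>a. y a - x a) + 0"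
      by (intro tendsto_intros LIMSEQ_inverse_real_of_nat)
    ultimately have "s \<le> r + ip I u (\<lambda>a. y a - x a)"
      by (intro LIMSEQ_le_const[of _ "r + ip I u (\<lambda>a. y a - x a)"]) auto
    then have "y = x"
      using strictly_convex_touching_point_unique[OF sc x u y(1)] s by simp
    then show False
      using y(2) \<epsilon> by (simp add: ip_def)
  qed
  then obtain n where n: "?K \<inter> F n = {}" by blast
  have "?q y < \<epsilon>" if y: "y \<in> Rsp I" "f y \<le> ereal (r + ip I u (\<lambda>a. y a - x a) + 1 / Suc n)" for y
  proof (rule ccontr)
    assume "\<not> ?q y < \<epsilon>"
    moreover have "?q y \<noteq> \<epsilon>"
      using n y by (auto simp: F_def)
    ultimately have big: "?q y > \<epsilon>" by simp
    obtain s where s: "f y = ereal s"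
      using Gamma0_finite_value[OF f y(1)] y(2) by fastforce
    \<comment> \<open>Squared distance to \<open>x\<close> scales by \<open>t * t\<close> along the
      segment, so this \<open>t\<close> places \<open>?w\<close> on the sphere.\<close>
    define t where "t = sqrt (\<epsilon> / ?q y)"
    have t: "0 < t" "t < 1" and tt: "t * t = \<epsilon> / ?q y"
      using big \<epsilon> by (auto simp: t_def)
    let ?w = "\<lambda>a. t * y a + (1 - t) * x a"
    obtain p where p: "f ?w = ereal p" "p \<le> t * s + (1 - t) * r"
      by (rule Gamma0_convex_value[of f I y x s r t, OF f y(1) x(1) s x(2) t])
    have wx: "(\<lambda>a. ?w a - x a) = (\<lambda>a. t * (y a - x a))"
      by (simp add: fun_eq_iff algebra_simps)
    have "?q ?w = t * t * ?q y"
      unfolding wx ip_scale_left ip_scale_right by simp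
    then have "?q ?w = \<epsilon>"
      using tt big \<epsilon> by simp
    moreover have "?w \<in> Rsp I"
      using x y by (intro Rsp_combination)
    \<comment> \<open>The gap is convex and vanishes at \<open>x\<close>, so at \<open>?w\<close> it
      is at most \<open>t\<close> times the gap at \<open>y\<close>.\<close>
    moreover have "p \<le> r + ip I u (\<lambda>a. ?w a - x a) + 1 / Suc n"
    proof -
      have "s \<le> r + ip I u (\<lambda>a. y a - x a) + 1 / Suc n"
        using y(2) s by simp
      then have "t * s \<le> t * (r + ip I u (\<lambda>a. y a - x a) + 1 / Suc n)"
        using t by simp
      moreover have "t * (1 / Suc n) \<le> 1 / Suc n"
        using t by (intro mult_left_le_one_le) simp_all
      ultimately show ?thesis
        unfolding wx ip_scale_right using p(2) by (simp add: algebra_simps)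
    qed
    ultimately have "?w \<in> ?K \<inter> F n"
      using p(1) by (simp add: F_def)
    then show False using n by blast
  qed
  then show ?thesis
    by (intro exI[of _ "1 / Suc n"]) simp
qed

text \<open>
  With \<open>\<eta> = 0\<close> this identifies subgradients with the gradient, and for \<open>\<eta> \<rightarrow> 0\<close> it
  shows that approximate subgradients converge to it.
\<close>

lemma approximate_subgradient_near_gradient:
  assumes I: "finite I" and x: "x \<in> Rsp I"
    and g: "has_gradient I f x g" and \<epsilon>: "\<epsilon> > 0"
  shows "\<exists>\<delta>>0. \<forall>u \<eta>.
    (\<forall>y\<in>Rsp I. real_of_ereal (f x) + ip I u (\<lambda>a. y a - x a) - \<eta> \<le> real_of_ereal (f y)) \<longrightarrow>
    (\<forall>a\<in>I. \<bar>u a - g a\<bar> \<le> \<epsilon> + \<eta> / \<delta>)"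
proof -
  have "\<exists>\<delta>>0. \<forall>h\<in>Rsp I. L2_set h I < \<delta> \<longrightarrow>
      \<bar>real_of_ereal (f (\<lambda>a. x a + h a)) - real_of_ereal (f x) - ip I g h\<bar> \<le> \<epsilon> * L2_set h I"
    using g \<epsilon> by (simp add: has_gradient_def)
  then obtain \<delta> where \<delta>: "\<delta> > 0" "\<forall>h\<in>Rsp I. L2_set h I < \<delta> \<longrightarrow>
      \<bar>real_of_ereal (f (\<lambda>a. x a + h a)) - real_of_ereal (f x) - ip I g h\<bar> \<le> \<epsilon> * L2_set h I"
    by (elim exE conjE)
  have "\<bar>u a - g a\<bar> \<le> \<epsilon> + \<eta> / (\<delta> / 2)"
    if u: "\<And>y. y \<in> Rsp I \<Longrightarrow>
        real_of_ereal (f x) + ip I u (\<lambda>a. y a - x a) - \<eta> \<le> real_of_ereal (f y)" and a: "a \<in> I"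
    for u \<eta> a
  proof -
    \<comment> \<open>Test one coordinate direction with length \<open>\<delta> / 2\<close>,
      strictly inside the range where the gradient estimate holds. Both signs of \<open>t\<close>
      are allowed, which later gives the absolute value.\<close>
    have step: "(u a - g a) * t \<le> \<epsilon> * (\<delta> / 2) + \<eta>" if t: "\<bar>t\<bar> = \<delta> / 2" for t
    proof -
      let ?h = "\<lambda>b. if b = a then t else 0"
      have h: "?h \<in> Rsp I" and L: "L2_set ?h I = \<delta> / 2"
        using a I t by (auto simp: Rsp_def L2_set_def if_distrib[of "\<lambda>c. c\<^sup>2"] cong: if_cong)
      have "\<bar>real_of_ereal (f (\<lambda>a. x a + ?h a)) - real_of_ereal (f x) - g a * t\<bar> \<le> \<epsilon> * (\<delta> / 2)"
        using bspec[OF \<delta>(2) h] \<delta>(1) ip_unit[OF I a] unfolding L by simp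
      moreover have "(\<lambda>b. x b + ?h b) \<in> Rsp I"
        using x a by (auto simp: Rsp_def)
      then have "real_of_ereal (f x) + u a * t - \<eta> \<le> real_of_ereal (f (\<lambda>a. x a + ?h a))"
        using u[of "\<lambda>b. x b + ?h b"] ip_unit[OF I a, of u t] by simp
      ultimately show ?thesis
        unfolding left_diff_distrib by linarith
    qed
    have "\<bar>u a - g a\<bar> * (\<delta> / 2) \<le> \<epsilon> * (\<delta> / 2) + \<eta>"
    proof (cases "0 \<le> u a - g a")
      case True
      then show ?thesis using step[of "\<delta> / 2"] \<delta>(1) by simp
    next
      case False
      then have "\<bar>u a - g a\<bar> = - (u a - g a)"
        by simp
      then have "\<bar>u a - g a\<bar> * (\<delta> / 2) = (u a - g a) * - (\<delta> / 2)"
        by (simp only: mult_minus_left mult_minus_right)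
      moreover have "\<bar>- (\<delta> / 2)\<bar> = \<delta> / 2"
        using \<delta>(1) by simp
      ultimately show ?thesis using step by metis
    qed
    then have "\<bar>u a - g a\<bar> \<le> (\<epsilon> * (\<delta> / 2) + \<eta>) / (\<delta> / 2)"
      using \<delta>(1) by (subst pos_le_divide_eq) simp_all
    then show ?thesis
      using \<delta>(1) by (simp add: add_divide_distrib)
  qed
  then show ?thesis
    using \<delta>(1) by (intro exI[of _ "\<delta> / 2"]) simp
qed

section \<open>One step of PDMM\<close>

lemma finite_primal_ix: "finite (primal_ix G)"
proof -
  have "primal_ix G = Sigma (nodes G) (\<lambda>i. {1..node_dim G i})"
    by (auto simp: primal_ix_def)
  then show ?thesis by (simp add: nodes_def)
qed

lemma finite_dual_ix:
  assumes "valid_network G"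
  shows "finite (dual_ix G)"
proof -
  from assms have "edges G \<subseteq> nodes G \<times> nodes G" "finite (nodes G \<times> nodes G)"
    by (simp_all add: valid_network_def nodes_def)
  then have "finite (edges G)"
    by (rule finite_subset)
  then have "finite (\<Union>(i, j)\<in>edges G. (\<lambda>r. (i, j, r)) ` {1..edge_dim G i j})"
    by auto
  moreover have "dual_ix G = (\<Union>(i, j)\<in>edges G. (\<lambda>r. (i, j, r)) ` {1..edge_dim G i j})"
    by (auto simp: dual_ix_def)
  ultimately show ?thesis by simp
qed

text \<open>Reversing edges permutes the dual labels, because the edge set and the edge dimensions
  are symmetric; hence \<open>opP\<close> is an isometry.\<close>

lemma ip_opP:
  assumes "valid_network G"
  shows "ip (dual_ix G) (opP u) (opP v) = ip (dual_ix G) u v"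
  unfolding ip_def
proof (rule sum.reindex_bij_witness[of _ "\<lambda>(i, j, r). (j, i, r)" "\<lambda>(i, j, r). (j, i, r)"])
  show "(case e of (i, j, r) \<Rightarrow> (j, i, r)) \<in> dual_ix G" if "e \<in> dual_ix G" for e
    using that assms by (auto simp: dual_ix_def valid_network_def sym_def)
  then show "(case e of (i, j, r) \<Rightarrow> (j, i, r)) \<in> dual_ix G" if "e \<in> dual_ix G" for e
    using that by blast
qed (auto simp: opP_def)

lemma opP_diff: "(\<lambda>e. opP u e - opP v e) = opP (\<lambda>e. u e - v e)"
  by (auto simp: opP_def)

lemma opC_adjoint: "ip (dual_ix G) (opC G x) v = ip (primal_ix G) x (opCt G v)"
  unfolding opC_def opCt_def by (rule mat_vec_adjoint)

text \<open>The dual update is exactly the vector whose image under the transpose appears in the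
  optimality condition of the primal update.\<close>

lemma pdmm_pair_subgradient:
  assumes f: "net_fun G \<in> Gamma0 (primal_ix G)" and pair: "pdmm_pair G \<rho> z x l"
  obtains r where "x \<in> Rsp (primal_ix G)" "net_fun G x = ereal r"
    "opCt G l \<in> subdiff (primal_ix G) (net_fun G) x"
proof -
  have min: "pdmm_objective G \<rho> z x \<le> pdmm_objective G \<rho> z y" if "y \<in> Rsp (primal_ix G)" for y
    using pair that by (auto simp: pdmm_pair_def is_arg_min_def not_less)
  have l: "l = (\<lambda>e. z e - \<rho> * (mat_vec (dual_ix G) (primal_ix G) (net_mat G) x e - vecd G e))"
    using pair by (simp add: pdmm_pair_def opC_def)
  have x: "x \<in> Rsp (primal_ix G)"
    using pair by (simp add: pdmm_pair_def is_arg_min_def)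
  show thesis
    by (rule argmin_penalized_subgradient[OF f x min[unfolded pdmm_objective_def opC_def opCt_def]])
       (use that x in \<open>simp_all add: l opCt_def\<close>)
qed

text \<open>Inverting the subgradient through the conjugate identifies the dual vector as a
  resolvent value, linking the arg min form of PDMM with its operator form.\<close>

lemma pdmm_pair_in_T1:
  assumes f: "net_fun G \<in> Gamma0 (primal_ix G)" and pair: "pdmm_pair G \<rho> z x l"
  shows "(\<lambda>e. opC G x e - vecd G e) \<in> T1 G l"
proof -
  obtain r where "x \<in> Rsp (primal_ix G)" "net_fun G x = ereal r"
    "opCt G l \<in> subdiff (primal_ix G) (net_fun G) x"
    using f pair by (rule pdmm_pair_subgradient)
  then have "x \<in> subdiff (primal_ix G) (conjugate (primal_ix G) (net_fun G)) (opCt G l)"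
    by (rule subdiff_conjugate)
  then show ?thesis
    unfolding T1_def by (rule imageI)
qed

text \<open>The fixed point property supplies some resolvent value \<open>l\<close>, while
  \<open>ls\<close> comes from a minimisation. Monotonicity of \<open>T1\<close> makes the resolvent
  single valued, so the two agree.\<close>

lemma fixed_point_eq_reflected_dual:
  assumes G: "valid_network G" and f: "net_fun G \<in> Gamma0 (primal_ix G)" and \<rho>: "\<rho> > 0"
    and mono: "monotone_op (dual_ix G) (T1 G)"
    and zs: "zs \<in> fix_pts (dual_ix G) (TP G \<rho>)" and pair: "pdmm_pair G \<rho> zs xs ls"
  shows "zs = opP (\<lambda>e. 2 * ls e - zs e)"
proof -
  let ?J = "dual_ix G" and ?us = "\<lambda>e. opC G xs e - vecd G e"
  obtain l u where l: "l \<in> Rsp ?J" "u \<in> T1 G l" "zs = (\<lambda>e. l e + \<rho> * u e)"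
    and fp: "zs = opP (\<lambda>e. 2 * l e - zs e)" and zsR: "zs \<in> Rsp ?J"
    using zs by (auto simp: fix_pts_def TP_def resolvent_def)
  have ls: "ls e = zs e - \<rho> * ?us e" for e
    using pair by (simp add: pdmm_pair_def)
  have lsR: "ls \<in> Rsp ?J"
    using zsR by (auto simp: Rsp_def ls opC_def mat_vec_def vecd_def)
  \<comment> \<open>Both decompositions sum to \<open>zs\<close>, so the differences of their parts
    are opposite up to \<open>\<rho>\<close>; monotonicity then forces both to vanish on
    \<open>?J\<close>.\<close>
  have d: "l e - ls e = - \<rho> * (u e - ?us e)" for e
    using fun_cong[OF l(3), of e] ls[of e] by (simp add: algebra_simps)
  have "0 \<le> ip ?J (\<lambda>e. u e - ?us e) (\<lambda>e. l e - ls e)"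
    using mono[unfolded monotone_op_def, THEN conjunct2, rule_format,
        OF l(1) lsR l(2) pdmm_pair_in_T1[OF f pair]] .
  also have "\<dots> = - \<rho> * ip ?J (\<lambda>e. u e - ?us e) (\<lambda>e. u e - ?us e)"
    unfolding d ip_scale_right ..
  finally have "ip ?J (\<lambda>e. u e - ?us e) (\<lambda>e. u e - ?us e) \<le> 0"
    using \<rho> by (simp add: mult_le_0_iff)
  then have "ip ?J (\<lambda>e. u e - ?us e) (\<lambda>e. u e - ?us e) = 0"
    using ip_self_nonneg by (rule antisym)
  then have "\<forall>e\<in>?J. u e - ?us e = 0"
    using ip_self_eq_0_iff[OF finite_dual_ix[OF G], of "\<lambda>e. u e - ?us e"] by blast
  then have "l e = ls e" for e
    using d[of e] l(1) lsR by (cases "e \<in> ?J") (simp_all add: Rsp_def del: split_paired_All)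
  then have "l = ls" by blast
  then show ?thesis using fp by simp
qed

text \<open>
  With \<open>\<Delta>z = \<Delta>\<lambda> + \<rho> C \<Delta>x\<close>, the next difference is \<open>P (\<Delta>\<lambda> - \<rho> C \<Delta>x)\<close>, so the two
  squared norms differ by the cross term only.
\<close>

lemma pdmm_distance_decrease:
  assumes G: "valid_network G" and pair: "pdmm_pair G \<rho> z x l" and pair': "pdmm_pair G \<rho> z' x' l'"
  shows "ip (dual_ix G) (\<lambda>e. opP (\<lambda>e. 2 * l e - z e) e - opP (\<lambda>e. 2 * l' e - z' e) e)
           (\<lambda>e. opP (\<lambda>e. 2 * l e - z e) e - opP (\<lambda>e. 2 * l' e - z' e) e) =
         ip (dual_ix G) (\<lambda>e. z e - z' e) (\<lambda>e. z e - z' e)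
           - 4 * \<rho> * ip (primal_ix G) (\<lambda>a. opCt G l a - opCt G l' a) (\<lambda>a. x a - x' a)"
proof -
  let ?J = "dual_ix G"
  define c where "c = (\<lambda>e. opC G x e - opC G x' e)"
  define m where "m = (\<lambda>e. l e - l' e)"
  have l: "l e = z e - \<rho> * (opC G x e - vecd G e)" "l' e = z' e - \<rho> * (opC G x' e - vecd G e)" for e
    using pair pair' by (simp_all add: pdmm_pair_def)
  have new: "(\<lambda>e. (2 * l e - z e) - (2 * l' e - z' e)) = (\<lambda>e. m e - \<rho> * c e)"
    and old: "(\<lambda>e. z e - z' e) = (\<lambda>e. m e + \<rho> * c e)"
    by (simp_all add: m_def c_def l fun_eq_iff algebra_simps)
  have "ip ?J m c = ip (primal_ix G) (\<lambda>a. opCt G l a - opCt G l' a) (\<lambda>a. x a - x' a)"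
    unfolding m_def c_def ip_diff_left ip_diff_right
    by (simp add: opC_adjoint ip_commute[of ?J _ "opC G _"] ip_commute[of "primal_ix G" _ "opCt G _"])
  then show ?thesis
    unfolding opP_diff ip_opP[OF G] new old ip_add_left ip_add_right ip_diff_left ip_diff_right
      ip_scale_left ip_scale_right
    by (simp add: ip_commute[of ?J c m])
qed

text \<open>A decreasing sequence bounded below converges, so its consecutive differences tend to
  0.\<close>

lemma telescoping_decrements_vanish:
  fixes a m :: "nat \<Rightarrow> real"
  assumes "\<And>k. 0 \<le> a k" "\<And>k. 0 \<le> m k" "\<And>k. a (Suc k) = a k - c * m k" "c > 0"
  shows "m \<longlonglongrightarrow> 0"
proof -
  have "decseq a"
    using assms by (intro decseq_SucI) simp
  then obtain L where L: "a \<longlonglongrightarrow> L"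
    using decseq_convergent[of a 0] assms(1) by blast
  then have "(\<lambda>k. (a k - a (Suc k)) / c) \<longlonglongrightarrow> (L - L) / c"
    by (intro tendsto_intros LIMSEQ_Suc) (use assms(4) in simp_all)
  moreover have "(\<lambda>k. (a k - a (Suc k)) / c) = m"
    using assms(3,4) by (auto simp: fun_eq_iff)
  ultimately show ?thesis by simp
qed


section \<open>Convergence of the primal and dual sequences\<close>

theorem lemmaV1:
  fixes G :: network and \<rho> :: real
    and z l :: "nat \<Rightarrow> nat \<times> nat \<times> nat \<Rightarrow> real" and x :: "nat \<Rightarrow> nat \<times> nat \<Rightarrow> real"
    and zs ls :: "nat \<times> nat \<times> nat \<Rightarrow> real" and xs :: "nat \<times> nat \<Rightarrow> real"
  assumes "valid_network G"
    and "net_fun G \<in> Gamma0 (primal_ix G)"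
    and "\<rho> > 0"
    and "maximal_monotone (dual_ix G) (T1 G)"
    and "fix_pts (dual_ix G) (TP G \<rho>) \<noteq> {}"
    and "zs \<in> fix_pts (dual_ix G) (TP G \<rho>)"
    and "pdmm_pair G \<rho> zs xs ls"
    and "pdmm_sequences G \<rho> z x l"
  shows "(strictly_convex_fn (primal_ix G) (net_fun G) \<longrightarrow> x \<longlonglongrightarrow> xs) \<and>
         (differentiable_fn (primal_ix G) (net_fun G) \<longrightarrow>
            (\<lambda>k. orth_proj (dual_ix G) (ranC G) (l k))
              \<longlonglongrightarrow> orth_proj (dual_ix G) (ranC G) ls)"
proof -
  let ?I = "primal_ix G" and ?J = "dual_ix G" and ?f = "net_fun G"
  note G = assms(1) and f = assms(2) and \<rho> = assms(3) and pairs = assms(7)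
  have fp: "zs = opP (\<lambda>e. 2 * ls e - zs e)"
    using assms(4) by (intro fixed_point_eq_reflected_dual[OF G f \<rho> _ assms(6) pairs])
      (simp add: maximal_monotone_def)
  have pair: "pdmm_pair G \<rho> (z k) (x (Suc k)) (l (Suc k))"
    and next_z: "z (Suc k) = opP (\<lambda>e. 2 * l (Suc k) e - z k e)" for k
    using assms(8) by (simp_all add: pdmm_sequences_def)
  obtain rs where xs: "xs \<in> Rsp ?I" "?f xs = ereal rs" and us: "opCt G ls \<in> subdiff ?I ?f xs"
    using f pairs by (rule pdmm_pair_subgradient)
  define r where "r = (\<lambda>k. real_of_ereal (?f (x (Suc k))))"
  \<comment> \<open>Index shift: \<open>z k\<close> produces the terms with index
    \<open>Suc k\<close>, so \<open>r k\<close> and the gaps below belong to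
    \<open>x (Suc k)\<close>.\<close>
  have xk: "x (Suc k) \<in> Rsp ?I" "?f (x (Suc k)) = ereal (r k)"
    "opCt G (l (Suc k)) \<in> subdiff ?I ?f (x (Suc k))" for k
    by (rule pdmm_pair_subgradient[OF f pair[of k]], simp add: r_def)+
  define gap where "gap = (\<lambda>k. r k - rs - ip ?I (opCt G ls) (\<lambda>a. x (Suc k) a - xs a))"
  define gap' where "gap' = (\<lambda>k. rs - r k - ip ?I (opCt G (l (Suc k))) (\<lambda>a. xs a - x (Suc k) a))"
  define m where "m = (\<lambda>k. ip ?I (\<lambda>a. opCt G (l (Suc k)) a - opCt G ls a) (\<lambda>a. x (Suc k) a - xs a))"
  have gap0: "0 \<le> gap k" and gap0': "0 \<le> gap' k" for k
    using subdiffD[where f = ?f, OF us xk(1) xs(2) xk(2), of k]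
      subdiffD[where f = ?f, OF xk(3) xs(1) xk(2) xs(2), of k]
    by (simp_all add: gap_def gap'_def)
  have m_gaps: "m k = gap k + gap' k" for k
    by (simp add: m_def gap_def gap'_def ip_linear)
  \<comment> \<open>By \<open>fp\<close> the reflected dual vector of the fixed point is
    \<open>zs\<close> again, which turns the one-step identity into a recursion for the distance to
    \<open>zs\<close>.\<close>
  have decrease: "ip ?J (\<lambda>e. z (Suc k) e - zs e) (\<lambda>e. z (Suc k) e - zs e) =
      ip ?J (\<lambda>e. z k e - zs e) (\<lambda>e. z k e - zs e) - 4 * \<rho> * m k" for k
    using pdmm_distance_decrease[OF G pair[of k] pairs] unfolding next_z[of k, symmetric] fp[symmetric]
    by (simp add: m_def)
  have m_lim: "m \<longlonglongrightarrow> 0"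
  proof (rule telescoping_decrements_vanish[of "\<lambda>k. ip ?J (\<lambda>e. z k e - zs e) (\<lambda>e. z k e - zs e)"])
    show "0 \<le> ip ?J (\<lambda>e. z k e - zs e) (\<lambda>e. z k e - zs e)" for k
      by (rule ip_self_nonneg)
    show "0 \<le> m k" for k
      using gap0[of k] gap0'[of k] by (simp add: m_gaps)
    show "0 < 4 * \<rho>"
      using \<rho> by simp
  qed (rule decrease)
  have gap_lim: "gap \<longlonglongrightarrow> 0"
    by (rule tendsto_sandwich[OF _ _ tendsto_const m_lim]) (use gap0 gap0' in \<open>simp_all add: m_gaps\<close>)
  have gap_lim': "gap' \<longlonglongrightarrow> 0"
    by (rule tendsto_sandwich[OF _ _ tendsto_const m_lim]) (use gap0 gap0' in \<open>simp_all add: m_gaps\<close>)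

  \<comment> \<open>Primal limit under strict convexity\<close>
  have "x \<longlonglongrightarrow> xs" if sc: "strictly_convex_fn ?I ?f"
  proof -
    have q: "(\<lambda>k. ip ?I (\<lambda>a. x (Suc k) a - xs a) (\<lambda>a. x (Suc k) a - xs a)) \<longlonglongrightarrow> 0"
    proof (rule order_tendstoI)
      fix b :: real assume "b < 0"
      then show "\<forall>\<^sub>F k in sequentially. b < ip ?I (\<lambda>a. x (Suc k) a - xs a) (\<lambda>a. x (Suc k) a - xs a)"
        using ip_self_nonneg by (intro always_eventually allI) (rule less_le_trans)
    next
      fix b :: real assume b: "0 < b"
      obtain \<delta> where \<delta>: "\<delta> > 0"
        "\<forall>y\<in>Rsp ?I. ?f y \<le> ereal (rs + ip ?I (opCt G ls) (\<lambda>a. y a - xs a) + \<delta>) \<longrightarrow>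
          ip ?I (\<lambda>a. y a - xs a) (\<lambda>a. y a - xs a) < b"
        using strictly_convex_small_gap_imp_close[OF finite_primal_ix f sc xs us b]
        by (elim exE conjE)
      have "\<forall>\<^sub>F k in sequentially. gap k < \<delta>"
        using gap_lim \<delta>(1) by (rule order_tendstoD)
      then show "\<forall>\<^sub>F k in sequentially. ip ?I (\<lambda>a. x (Suc k) a - xs a) (\<lambda>a. x (Suc k) a - xs a) < b"
      proof eventually_elim
        case (elim k)
        then show ?case
          using bspec[OF \<delta>(2) xk(1), of k] by (simp add: xk(2) gap_def)
      qed
    qed
    have "(\<lambda>k. x (Suc k) a) \<longlonglongrightarrow> xs a" for a
    proof (cases "a \<in> ?I")
      case True
      have "(\<lambda>k. (x (Suc k) a - xs a)\<^sup>2) \<longlonglongrightarrow> 0"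
        using square_coordinate_le_ip[OF finite_primal_ix True, of "\<lambda>a. x (Suc _) a - xs a"]
        by (intro tendsto_sandwich[OF _ _ tendsto_const q]) simp_all
      then have "(\<lambda>k. x (Suc k) a - xs a) \<longlonglongrightarrow> 0"
        by simp
      then show ?thesis
        by (simp add: LIM_zero_iff)
    next
      case False
      then show ?thesis
        using xk(1) xs(1) by (simp add: Rsp_def del: split_paired_All)
    qed
    then have "(\<lambda>k. x (Suc k)) \<longlonglongrightarrow> xs"
      by (simp add: tendsto_coordinatewise_iff)
    then show ?thesis
      by (rule LIMSEQ_imp_Suc)
  qed

  \<comment> \<open>Projected dual limit under differentiability\<close>
  moreover have "(\<lambda>k. orth_proj ?J (ranC G) (l k)) \<longlonglongrightarrow> orth_proj ?J (ranC G) ls"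
    if diff: "differentiable_fn ?I ?f"
  proof -
    have fin: "\<bar>?f y\<bar> \<noteq> \<infinity>" if "y \<in> Rsp ?I" for y
      using diff that by (simp add: differentiable_fn_def)
    then have real: "?f y = ereal (real_of_ereal (?f y))" if "y \<in> Rsp ?I" for y
      using that by (simp add: ereal_real)
    obtain g where g: "has_gradient ?I ?f xs g"
      using diff xs(1) by (auto simp: differentiable_fn_def)
    \<comment> \<open>The subtracted 0 is the slack \<open>\<eta>\<close> of an exact
      subgradient.\<close>
    have sub: "real_of_ereal (?f xs) + ip ?I (opCt G ls) (\<lambda>a. y a - xs a) - 0 \<le> real_of_ereal (?f y)"
      if "y \<in> Rsp ?I" for y
      using subdiffD[where f = ?f, OF us that xs(2) real[OF that]] xs(2) by simp
    \<comment> \<open>Moving the base point of the subgradient inequality from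
      \<open>x (Suc k)\<close> to \<open>xs\<close> costs exactly \<open>gap' k\<close>.\<close>
    have sub': "real_of_ereal (?f xs) + ip ?I (opCt G (l (Suc k))) (\<lambda>a. y a - xs a) - gap' k
        \<le> real_of_ereal (?f y)" if "y \<in> Rsp ?I" for y k
      using subdiffD[where f = ?f, OF xk(3) that xk(2) real[OF that], of k] xs(2) by (simp add: gap'_def ip_linear)
    have "opCt G ls a = g a" if a: "a \<in> ?I" for a
    proof -
      have "\<bar>opCt G ls a - g a\<bar> \<le> 0 + \<epsilon>" if \<epsilon>: "\<epsilon> > 0" for \<epsilon>
        using approximate_subgradient_near_gradient[OF finite_primal_ix xs(1) g \<epsilon>] sub a
        by fastforce
      then have "\<bar>opCt G ls a - g a\<bar> \<le> 0"
        by (rule field_le_epsilon)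
      then show ?thesis by simp
    qed
    moreover have "(\<lambda>k. opCt G (l (Suc k)) a) \<longlonglongrightarrow> g a" if a: "a \<in> ?I" for a
    proof (rule LIMSEQ_I)
      fix b :: real assume b: "0 < b"
      \<comment> \<open>Half of \<open>b\<close> covers the gradient error, the other half
        \<open>gap' k / \<delta>\<close>.\<close>
      then have b2: "0 < b / 2" by simp
      obtain \<delta> where \<delta>: "\<delta> > 0"
        "\<forall>u \<eta>. (\<forall>y\<in>Rsp ?I.
          real_of_ereal (?f xs) + ip ?I u (\<lambda>a. y a - xs a) - \<eta> \<le> real_of_ereal (?f y)) \<longrightarrow>
          (\<forall>a\<in>?I. \<bar>u a - g a\<bar> \<le> b / 2 + \<eta> / \<delta>)"
        using approximate_subgradient_near_gradient[OF finite_primal_ix xs(1) g b2]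
        by (elim exE conjE)
      have close: "\<bar>opCt G (l (Suc k)) a - g a\<bar> \<le> b / 2 + gap' k / \<delta>" for k
        using \<delta>(2)[THEN spec[of _ "opCt G (l (Suc k))"], THEN spec[of _ "gap' k"]] sub' a by simp
      have "\<forall>\<^sub>F k in sequentially. gap' k < \<delta> * (b / 2)"
        using order_tendstoD(2)[OF gap_lim', of "\<delta> * (b / 2)"] \<delta>(1) b by simp
      then obtain N where N: "\<And>k. k \<ge> N \<Longrightarrow> gap' k < \<delta> * (b / 2)"
        by (auto simp: eventually_sequentially)
      have "norm (opCt G (l (Suc k)) a - g a) < b" if "k \<ge> N" for k
      proof -
        have "gap' k / \<delta> < b / 2"
          using N[OF that] \<delta>(1) by (simp add: pos_divide_less_eq mult.commute)
        then show ?thesis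
          using close[of k] unfolding real_norm_def by linarith
      qed
      then show "\<exists>N. \<forall>k\<ge>N. norm (opCt G (l (Suc k)) a - g a) < b"
        by blast
    qed
    ultimately have Ct_lim: "(\<lambda>k. opCt G (l (Suc k)) a) \<longlonglongrightarrow> opCt G ls a" if "a \<in> ?I" for a
      using that by simp
    obtain W where W: "finite W" "W \<subseteq> ranC G"
      and proj: "\<And>v. orth_proj ?J (ranC G) v = (\<lambda>e. \<Sum>w\<in>W. ip ?J w v * w e)"
      using orth_proj_range_expansion[OF finite_dual_ix[OF G] finite_primal_ix, of G "net_mat G"]
      unfolding ranC_def opC_def by blast
    have "(\<lambda>k. ip ?J w (l (Suc k))) \<longlonglongrightarrow> ip ?J w ls" if w: "w \<in> W" for w
    proof -
      \<comment> \<open>Writing \<open>w\<close> as an image moves \<open>opC\<close> across the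
        inner product, so convergence of \<open>opCt G (l (Suc k))\<close> on \<open>?I\<close>
        suffices.\<close>
      obtain y where y: "w = opC G y"
        using subsetD[OF W(2) w] by (auto simp: ranC_def)
      show ?thesis
        unfolding y opC_adjoint unfolding ip_def by (intro tendsto_intros Ct_lim)
    qed
    then have "(\<lambda>k. orth_proj ?J (ranC G) (l (Suc k))) \<longlonglongrightarrow> orth_proj ?J (ranC G) ls"
      unfolding proj tendsto_coordinatewise_iff by (intro allI tendsto_intros)
    then show ?thesis
      by (rule LIMSEQ_imp_Suc)
  qed
  ultimately show ?thesis by blast
qed

end
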